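(* Assume the following. (A1) There exists $\mathcal{K}_{\mathcal{H}}>0$ such that every $h\in\mathcal{H}$ is a bounded $\mathcal{K}_{\mathcal{H}}$-Lipschitz map $\mathcal{X}\to\mathcal{Y}$, and $\sup_{h\in\mathcal{H}}\|h\|_\infty<\infty$. (A2) There exists $\mathcal{K}_\ell>0$ such that the loss $\ell:\mathcal{Y}\times\mathcal{Y}\to[0,\infty)$ is bounded and $\mathcal{K}_\ell$-Lipschitz, and $M:=\sup_{h\in\mathcal{H}}\sup_{(x,y)\in\mathcal{Z}}|\ell(h(x),y)|<\infty$. Assume also that $\{Z_t=(X_t,Y_t),\,t\in\mathbb{Z}\}$ is stationary ergodic and $(\Lambda_1(\mathcal{X}\times\mathcal{Y}),\psi,\epsilon)$-weakly dependent, where $\psi$ is one of the four functions ($\theta$, $\eta$, $\kappa$ or $\lambda$ type) listed in the context and $\epsilon_j=\mathcal{O}(j^{-\gamma})$ for some $\gamma>3$, and that the covering number $\mathcal{N}(\mathcal{H},r)$ is finite for every $r>0$. Then $\sup_{h\in\mathcal{H}}|R(h)-\widehat{R}_n(h)|\to0$ in probability as $n\to\infty$, and the empirical risk minimization algorithm is consistent within $\mathcal{H}$: $R(\widehat{h}_n)-R(h_{\mathcal{H}})\to0$ in probability as $n\to\infty$.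
   Context: Setting. $\mathcal{X}$ and $\mathcal{Y}$ are subsets of separable Banach spaces with norms $\|\cdot\|_{\mathcal{X}},\|\cdot\|_{\mathcal{Y}}$, and $\mathcal{Z}=\mathcal{X}\times\mathcal{Y}$. The process $\{Z_t=(X_t,Y_t),\,t\in\mathbb{Z}\}$ is stationary and ergodic with values in $\mathcal{Z}$; $Z_1,\dots,Z_n$ is the observed sample. $\mathcal{H}$ is a set of functions (predictors) $h:\mathcal{X}\to\mathcal{Y}$, and $\ell:\mathcal{Y}\times\mathcal{Y}\to[0,\infty)$ is a loss function. The risk and empirical risk are $$R(h)=\mathbb{E}[\ell(h(X_0),Y_0)],\qquad \widehat{R}_n(h)=\frac1n\sum_{i=1}^n\ell(h(X_i),Y_i).$$ The target $h_{\mathcal{H}}\in\operatorname{argmin}_{h\in\mathcal{H}}R(h)$ and the empirical target $\widehat{h}_n\in\operatorname{argmin}_{h\in\mathcal{H}}\widehat{R}_n(h)$ are assumed to exist; $R(\widehat{h}_n)$ denotes the function $R$ evaluated at the (random) element $\widehat{h}_n$. Finite products of normed spaces carry the sum norm $\|(x_1,\dots,x_k)\|=\|x_1\|+\dots+\|x_k\|$. For a function $h$, $\|h\|_\infty=\sup_x\|h(x)\|$ and $\mathrm{Lip}(h)=\sup_{x_1\ne x_2}\|h(x_1)-h(x_2)\|/\|x_1-x_2\|$. For $r>0$, $\mathcal{N}(\mathcal{H},r)$ is the $r$-covering number: the least $m\ge1$ such that there are $h_1,\dots,h_m\in\mathcal{H}$ with every $h\in\mathcal{H}$ satisfying $\|h-h_i\|_\infty\le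 r$ for some $i$. Weak dependence. For $E$ a separable Banach space (or the set $\mathcal{Z}$ with the sum norm), $\Lambda_1(E)$ is the set of functions $g:E^u\to\mathbb{R}$, for some $u\in\mathbb{N}$, with $\|g\|_\infty<\infty$ and $\mathrm{Lip}(g)\le1$. An $E$-valued process $(Z_t)_{t\in\mathbb{Z}}$ is $(\Lambda_1(E),\psi,\epsilon)$-weakly dependent if $\psi:[0,\infty)^2\times\mathbb{N}^2\to[0,\infty)$ is a function and $\epsilon=(\epsilon(r))_{r\in\mathbb{N}}$ is a sequence decreasing to zero at infinity (written $\epsilon_r=\epsilon(r)$) such that for all $g_1,g_2\in\Lambda_1(E)$, $g_1:E^u\to\mathbb{R}$, $g_2:E^v\to\mathbb{R}$, and all $s_1\le\dots\le s_u\le s_u+r\le t_1\le\dots\le t_v$, $$|\mathrm{Cov}(g_1(Z_{s_1},\dots,Z_{s_u}),g_2(Z_{t_1},\dots,Z_{t_v}))|\le\psi(\mathrm{Lip}(g_1),\mathrm{Lip}(g_2),u,v)\,\epsilon(r).$$ The four choices of $\psi(\mathrm{Lip}(g_1),\mathrm{Lip}(g_2),u,v)$ are: $v\,\mathrm{Lip}(g_2)$ ($\theta$-weak dependence); $u\,\mathrm{Lip}(g_1)+v\,\mathrm{Lip}(g_2)$ ($\eta$); $uv\,\mathrm{Lip}(g_1)\mathrm{Lip}(g_2)$ ($\kappa$); $u\,\mathrm{Lip}(g_1)+v\,\mathrm{Lip}(g_2)+uv\,\mathrm{Lip}(g_1)\mathrm{Lip}(g_2)$ ($\lambda$). *)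

theory Defs
  imports "HOL-Probability.Probability"
begin

section \<open>Norms, Lipschitz constants and covering numbers\<close>

text \<open>
  A function between sets \<open>S \<rightarrow> T\<close> is represented by a total function of which only the values
  on \<open>S\<close> matter; every notion below looks at the restriction to \<open>S\<close> only. Suprema that may be
  infinite are taken in \<^typ>\<open>ennreal\<close>.
\<close>

definition sup_norm_on :: "'c set \<Rightarrow> ('c \<Rightarrow> 'd::real_normed_vector) \<Rightarrow> ennreal" where
  "sup_norm_on S f = (SUP x\<in>S. ennreal (norm (f x)))"

definition lip_const :: "('c \<Rightarrow> 'c \<Rightarrow> real) \<Rightarrow> 'c set \<Rightarrow> ('c \<Rightarrow> real) \<Rightarrow> ennreal" where
  "lip_const d S f =
     (SUP (x, y) \<in> {(x, y). x \<in> S \<and> y \<in> S \<and> x \<noteq> y}. ennreal (\<bar>f x - f y\<bar> / d x y))"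

text \<open>
  The library norm on a product type is the Euclidean one, so the distance of the sum norm
  has to be introduced separately.
\<close>

definition sum_dist :: "'a::real_normed_vector \<times> 'b::real_normed_vector \<Rightarrow> 'a \<times> 'b \<Rightarrow> real" where
  "sum_dist p q = norm (fst p - fst q) + norm (snd p - snd q)"

text \<open>The power \<open>S\<^sup>u\<close> is the set of extensional functions on \<open>{1..u}\<close>, with the sum distance.\<close>

definition tuples :: "'e set \<Rightarrow> nat \<Rightarrow> (nat \<Rightarrow> 'e) set" where
  "tuples S u = {1..u} \<rightarrow>\<^sub>E S"

definition tuple_dist :: "('e \<Rightarrow> 'e \<Rightarrow> real) \<Rightarrow> nat \<Rightarrow> (nat \<Rightarrow> 'e) \<Rightarrow> (nat \<Rightarrow> 'e) \<Rightarrow> real" where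
  "tuple_dist d u x y = (\<Sum>i = 1..u. d (x i) (y i))"

definition covering_number ::
    "'a set \<Rightarrow> ('a \<Rightarrow> 'b::real_normed_vector) set \<Rightarrow> real \<Rightarrow> enat" where
  "covering_number \<X> \<H> r =
     Inf {enat m | m. 1 \<le> m \<and>
       (\<exists>c :: nat \<Rightarrow> 'a \<Rightarrow> 'b. (\<forall>i\<in>{1..m}. c i \<in> \<H>) \<and>
          (\<forall>h\<in>\<H>. \<exists>i\<in>{1..m}. sup_norm_on \<X> (\<lambda>x. h x - c i x) \<le> ennreal r))}"


section \<open>Processes indexed by the integers\<close>

definition path_law :: "'w measure \<Rightarrow> 'e measure \<Rightarrow> (int \<Rightarrow> 'w \<Rightarrow> 'e) \<Rightarrow> (int \<Rightarrow> 'e) measure" where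
  "path_law M S Z = distr M (Pi\<^sub>M UNIV (\<lambda>_. S)) (\<lambda>\<omega> t. Z t \<omega>)"

definition stationary :: "'w measure \<Rightarrow> 'e measure \<Rightarrow> (int \<Rightarrow> 'w \<Rightarrow> 'e) \<Rightarrow> bool" where
  "stationary M S Z \<longleftrightarrow> (\<forall>k. path_law M S (\<lambda>t. Z (t + k)) = path_law M S Z)"

definition ergodic :: "'w measure \<Rightarrow> 'e measure \<Rightarrow> (int \<Rightarrow> 'w \<Rightarrow> 'e) \<Rightarrow> bool" where
  "ergodic M S Z \<longleftrightarrow>
     (\<forall>A\<in>sets (Pi\<^sub>M UNIV (\<lambda>_. S)).
        {x \<in> space (Pi\<^sub>M UNIV (\<lambda>_. S)). (\<lambda>t. x (t + 1)) \<in> A} = A \<longrightarrow>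
        measure (path_law M S Z) A \<in> {0, 1})"

definition Cov :: "'w measure \<Rightarrow> ('w \<Rightarrow> real) \<Rightarrow> ('w \<Rightarrow> real) \<Rightarrow> real" where
  "Cov M U V = (\<integral>\<omega>. (U \<omega> - (\<integral>\<omega>'. U \<omega>' \<partial>M)) * (V \<omega> - (\<integral>\<omega>'. V \<omega>' \<partial>M)) \<partial>M)"

text \<open>
  The outer measure agrees with \<^const>\<open>emeasure\<close> on measurable sets, so for random variables
  this is ordinary convergence in probability; it is also meaningful when measurability of
  \<open>W n\<close> (e.g. of an uncountable supremum) has not been established.
\<close>

definition tendsto_in_prob :: "'w measure \<Rightarrow> (nat \<Rightarrow> 'w \<Rightarrow> real) \<Rightarrow> ('w \<Rightarrow> real) \<Rightarrow> bool" where
  "tendsto_in_prob M W L \<longleftrightarrow>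
     (\<forall>e>0. (\<lambda>n. outer_measure_of M {\<omega> \<in> space M. \<bar>W n \<omega> - L \<omega>\<bar> > e}) \<longlonglongrightarrow> 0)"


section \<open>Weak dependence\<close>

definition Lambda1 :: "('e \<Rightarrow> 'e \<Rightarrow> real) \<Rightarrow> 'e set \<Rightarrow> nat \<Rightarrow> ((nat \<Rightarrow> 'e) \<Rightarrow> real) set" where
  "Lambda1 d S u =
     {g. sup_norm_on (tuples S u) g < \<infinity> \<and> lip_const (tuple_dist d u) (tuples S u) g \<le> 1}"

text \<open>Here the natural numbers start at 1, for the gap \<open>r\<close> as well as for \<open>u\<close> and \<open>v\<close>.\<close>

definition weakly_dependent ::
    "'w measure \<Rightarrow> ('e \<Rightarrow> 'e \<Rightarrow> real) \<Rightarrow> 'e set \<Rightarrow> (int \<Rightarrow> 'w \<Rightarrow> 'e) \<Rightarrow>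
     (real \<Rightarrow> real \<Rightarrow> nat \<Rightarrow> nat \<Rightarrow> real) \<Rightarrow> (nat \<Rightarrow> real) \<Rightarrow> bool" where
  "weakly_dependent M d S Z \<psi> \<epsilon> \<longleftrightarrow>
     (\<forall>a\<ge>0. \<forall>b\<ge>0. \<forall>u\<ge>1. \<forall>v\<ge>1. 0 \<le> \<psi> a b u v) \<and>
     antimono_on {1..} \<epsilon> \<and> \<epsilon> \<longlonglongrightarrow> 0 \<and>
     (\<forall>u\<ge>1. \<forall>v\<ge>1. \<forall>r\<ge>1. \<forall>g1\<in>Lambda1 d S u. \<forall>g2\<in>Lambda1 d S v. \<forall>s t.
        mono_on {1..u} s \<and> s u + int r \<le> t 1 \<and> mono_on {1..v} t \<longrightarrow>
        \<bar>Cov M (\<lambda>\<omega>. g1 (\<lambda>i\<in>{1..u}. Z (s i) \<omega>)) (\<lambda>\<omega>. g2 (\<lambda>i\<in>{1..v}. Z (t i) \<omega>))\<bar>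
          \<le> \<psi> (enn2real (lip_const (tuple_dist d u) (tuples S u) g1))
              (enn2real (lip_const (tuple_dist d v) (tuples S v) g2)) u v * \<epsilon> r)"

definition psi_theta :: "real \<Rightarrow> real \<Rightarrow> nat \<Rightarrow> nat \<Rightarrow> real" where
  "psi_theta a b u v = real v * b"

definition psi_eta :: "real \<Rightarrow> real \<Rightarrow> nat \<Rightarrow> nat \<Rightarrow> real" where
  "psi_eta a b u v = real u * a + real v * b"

definition psi_kappa :: "real \<Rightarrow> real \<Rightarrow> nat \<Rightarrow> nat \<Rightarrow> real" where
  "psi_kappa a b u v = real u * real v * a * b"

definition psi_lambda :: "real \<Rightarrow> real \<Rightarrow> nat \<Rightarrow> nat \<Rightarrow> real" where
  "psi_lambda a b u v = real u * a + real v * b + real u * real v * a * b"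


section \<open>Risk and empirical risk\<close>

definition risk ::
    "'w measure \<Rightarrow> ('b \<times> 'b \<Rightarrow> real) \<Rightarrow> (int \<Rightarrow> 'w \<Rightarrow> 'a) \<Rightarrow> (int \<Rightarrow> 'w \<Rightarrow> 'b) \<Rightarrow>
     ('a \<Rightarrow> 'b) \<Rightarrow> real" where
  "risk M l X Y h = (\<integral>\<omega>. l (h (X 0 \<omega>), Y 0 \<omega>) \<partial>M)"

definition emp_risk ::
    "('b \<times> 'b \<Rightarrow> real) \<Rightarrow> (int \<Rightarrow> 'w \<Rightarrow> 'a) \<Rightarrow> (int \<Rightarrow> 'w \<Rightarrow> 'b) \<Rightarrow> nat \<Rightarrow> 'w \<Rightarrow>
     ('a \<Rightarrow> 'b) \<Rightarrow> real" where
  "emp_risk l X Y n \<omega> h = 1 / real n * (\<Sum>i = 1..n. l (h (X (int i) \<omega>), Y (int i) \<omega>))"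

end

theory Submission
  imports Defs
begin

text \<open>
  For a single predictor \<open>h\<close> the loss \<open>f h (x, y) = l (h x, y)\<close> is bounded and Lipschitz on
  \<open>\<X> \<times> \<Y>\<close>. Weak dependence therefore bounds the covariance of \<open>f h (Z s)\<close> and \<open>f h (Z t)\<close> by a
  constant times \<open>\<epsilon> (t - s)\<close> (\<open>weakly_dependent_cov_le\<close>). As \<open>\<epsilon>\<close> vanishes at infinity, the
  variance of the sample mean vanishes too, and Chebyshev's inequality together with stationarity
  gives the weak law \<open>R_emp n h \<rightarrow> R h\<close> in probability (\<open>weak_law_decaying_covariance\<close>).

  The step to all \<open>h\<close> at once is compactness: the loss is Lipschitz, so predictors that are
  uniformly close have close risks and close empirical risks, whatever the sample is. A finite
  cover of \<open>\<H>\<close> thus reduces a large deviation of the supremum to a large deviation at one of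
  finitely many centres (\<open>uniform_law_finite_cover\<close>). Bounding the event by a finite union of
  measurable ones also avoids any question about the measurability of the supremum.

  Finally, the excess risk of an empirical minimizer is at most twice the uniform deviation
  (\<open>excess_risk_le\<close>), so that consistency follows from the uniform law.
\<close>

section \<open>A weak law of large numbers from decaying covariances\<close>

lemma cesaro_mean_tendsto_zero:
  fixes b :: "nat \<Rightarrow> real"
  assumes "b \<longlonglongrightarrow> 0"
  shows "(\<lambda>n. (\<Sum>r<n. b r) / real n) \<longlonglongrightarrow> 0"
proof (rule LIMSEQ_I)
  fix e :: real assume e: "e > 0"
  from LIMSEQ_D[OF assms, of "e/2"] e obtain N where N: "\<And>r. r \<ge> N \<Longrightarrow> \<bar>b r\<bar> < e / 2"
    by auto
  define C where "C = (\<Sum>r<N. \<bar>b r\<bar>)"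
  have "(\<lambda>n. C / real n) \<longlonglongrightarrow> 0" by (rule lim_const_over_n)
  from LIMSEQ_D[OF this, of "e/2"] e obtain N' where N': "\<And>n. n \<ge> N' \<Longrightarrow> C / real n < e / 2"
    by (fastforce simp: C_def sum_nonneg)
  show "\<exists>no. \<forall>n\<ge>no. norm ((\<Sum>r<n. b r) / real n - 0) < e"
  proof (intro exI allI impI)
    fix n assume n: "n \<ge> Suc (max N N')"
    then have pos: "real n > 0" by simp
    have "\<bar>\<Sum>r<n. b r\<bar> \<le> (\<Sum>r<n. \<bar>b r\<bar>)" by (rule sum_abs)
    also have "\<dots> = C + (\<Sum>r=N..<n. \<bar>b r\<bar>)"
      unfolding C_def using n sum.atLeastLessThan_concat[of 0 N n "\<lambda>r. \<bar>b r\<bar>"]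
      by (simp add: atLeast0LessThan)
    also have "(\<Sum>r=N..<n. \<bar>b r\<bar>) \<le> (\<Sum>r=N..<n. e / 2)"
      using N by (intro sum_mono less_imp_le) auto
    also have "\<dots> \<le> real n * (e / 2)"
      using n e by (simp add: mult_right_mono)
    finally have "\<bar>\<Sum>r<n. b r\<bar> / real n \<le> (C + real n * (e / 2)) / real n"
      using pos by (simp add: divide_right_mono)
    also have "\<dots> = C / real n + e / 2" using pos by (simp add: field_simps)
    also have "\<dots> < e / 2 + e / 2" using N'[of n] n by (intro add_strict_right_mono) simp
    finally show "norm ((\<Sum>r<n. b r) / real n - 0) < e" by (simp add: abs_divide)
  qed
qed

lemma abs_mean_le:
  fixes g :: "nat \<Rightarrow> real"
  assumes "\<And>i. \<bar>g i\<bar> \<le> b"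
  shows "\<bar>(\<Sum>i=1..n. g i) / real n\<bar> \<le> b"
proof (cases "n = 0")
  case True
  then show ?thesis using assms[of 0] by simp
next
  case False
  have "\<bar>\<Sum>i=1..n. g i\<bar> \<le> (\<Sum>i=1..n. b)"
    using assms by (intro order_trans[OF sum_abs] sum_mono)
  then show ?thesis using False by (simp add: field_simps)
qed

lemma (in prob_space) abs_expectation_le:
  fixes g :: "'a \<Rightarrow> real"
  assumes "integrable M g" "\<And>\<omega>. \<omega> \<in> space M \<Longrightarrow> \<bar>g \<omega>\<bar> \<le> b"
  shows "\<bar>expectation g\<bar> \<le> b"
proof -
  have "\<bar>expectation g\<bar> \<le> expectation (\<lambda>\<omega>. \<bar>g \<omega>\<bar>)" by (rule integral_abs_bound)
  also have "\<dots> \<le> b" using assms by (intro integral_le_const) auto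
  finally show ?thesis .
qed

text \<open>
  In the double sum of covariances each row meets a gap \<open>r < n\<close> at most twice, once on either side
  of the diagonal; one of the two factors \<open>1 / n\<close> is then used up by the number of rows.
\<close>

lemma (in prob_space) variance_mean_le:
  fixes V :: "nat \<Rightarrow> 'a \<Rightarrow> real"
  assumes meas: "\<And>i. V i \<in> borel_measurable M"
    and bounded: "\<And>i \<omega>. \<omega> \<in> space M \<Longrightarrow> \<bar>V i \<omega>\<bar> \<le> B"
    and cov: "\<And>i j. 1 \<le> i \<Longrightarrow> i \<le> j \<Longrightarrow> \<bar>Cov M (V i) (V j)\<bar> \<le> b (j - i)"
    and n: "n \<ge> 1"
  shows "variance (\<lambda>\<omega>. (\<Sum>i=1..n. V i \<omega>) / real n) \<le> 2 * ((\<Sum>r<n. b r) / real n)"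
proof -
  note meas[measurable]
  have int: "integrable M (V i)" for i
    using bounded by (intro integrable_const_bound[where B=B]) auto
  define m where "m i = expectation (V i)" for i
  have m_le: "\<bar>m i\<bar> \<le> B" for i
    unfolding m_def using int bounded by (rule abs_expectation_le)
  have cent_le: "\<bar>V i \<omega> - m i\<bar> \<le> 2 * B" if "\<omega> \<in> space M" for i \<omega>
    using m_le[of i] bounded[OF that, of i] by linarith
  have intc: "integrable M (\<lambda>\<omega>. (V i \<omega> - m i) * (V j \<omega> - m j))" for i j
  proof (intro integrable_const_bound[where B="(2*B)*(2*B)"] AE_I2)
    fix \<omega> assume w: "\<omega> \<in> space M"
    show "norm ((V i \<omega> - m i) * (V j \<omega> - m j)) \<le> 2 * B * (2 * B)"
      unfolding real_norm_def abs_mult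
      using cent_le[OF w, of i] cent_le[OF w, of j] by (intro mult_mono) auto
  qed simp
  have b_nonneg: "0 \<le> b r" for r
    using order_trans[OF abs_ge_zero cov[of 1 "1 + r"]] by simp
  have cov': "\<bar>Cov M (V i) (V j)\<bar> \<le> b (if i \<le> j then j - i else i - j)" if "i \<ge> 1" "j \<ge> 1" for i j
  proof (cases "i \<le> j")
    case False
    have "Cov M (V i) (V j) = Cov M (V j) (V i)" unfolding Cov_def by (simp add: mult.commute)
    with False that cov[of j i] show ?thesis by simp
  qed (use that cov in simp)
  have row: "(\<Sum>j=1..n. \<bar>Cov M (V i) (V j)\<bar>) \<le> 2 * (\<Sum>r<n. b r)" if i: "i \<in> {1..n}" for i
  proof -
    have "(\<Sum>j=1..n. \<bar>Cov M (V i) (V j)\<bar>) = (\<Sum>j\<in>{i..n}\<union>{1..<i}. \<bar>Cov M (V i) (V j)\<bar>)"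
      using i by (intro sum.cong) auto
    also have "\<dots> = (\<Sum>j=i..n. \<bar>Cov M (V i) (V j)\<bar>) + (\<Sum>j=1..<i. \<bar>Cov M (V i) (V j)\<bar>)"
      by (intro sum.union_disjoint) auto
    also have "(\<Sum>j=i..n. \<bar>Cov M (V i) (V j)\<bar>) \<le> (\<Sum>j=i..n. b (j - i))"
      using i by (intro sum_mono cov) auto
    also have "\<dots> = (\<Sum>r\<in>(\<lambda>j. j - i) ` {i..n}. b r)"
      by (subst sum.reindex) (auto simp: inj_on_def)
    also have "\<dots> \<le> (\<Sum>r<n. b r)"
      using i b_nonneg by (intro sum_mono2) auto
    also have "(\<Sum>j=1..<i. \<bar>Cov M (V i) (V j)\<bar>) \<le> (\<Sum>j=1..<i. b (i - j))"
      using i by (intro sum_mono order_trans[OF cov']) auto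
    also have "\<dots> = (\<Sum>r\<in>(\<lambda>j. i - j) ` {1..<i}. b r)"
      by (subst sum.reindex) (auto simp: inj_on_def)
    also have "\<dots> \<le> (\<Sum>r<n. b r)"
      using i b_nonneg by (intro sum_mono2) auto
    finally show ?thesis by simp
  qed
  have E: "expectation (\<lambda>\<omega>. (\<Sum>i=1..n. V i \<omega>) / real n) = (\<Sum>i=1..n. m i) / real n"
    unfolding m_def using int by simp
  have sq: "((\<Sum>i=1..n. V i \<omega>) / real n - (\<Sum>i=1..n. m i) / real n)\<^sup>2
      = (\<Sum>i=1..n. \<Sum>j=1..n. (V i \<omega> - m i) * (V j \<omega> - m j)) / (real n)\<^sup>2" for \<omega>
  proof -
    have "(\<Sum>i=1..n. V i \<omega>) / real n - (\<Sum>i=1..n. m i) / real n = (\<Sum>i=1..n. V i \<omega> - m i) / real n"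
      by (simp add: sum_subtractf diff_divide_distrib)
    then show ?thesis
      by (simp add: power_divide power2_eq_square sum_product)
  qed
  have "variance (\<lambda>\<omega>. (\<Sum>i=1..n. V i \<omega>) / real n)
      = (\<Sum>i=1..n. \<Sum>j=1..n. Cov M (V i) (V j)) / (real n)\<^sup>2"
    unfolding E sq Cov_def m_def[symmetric] using intc by (simp add: Bochner_Integration.integral_sum)
  also have "\<dots> \<le> (\<Sum>i=1..n. \<Sum>j=1..n. \<bar>Cov M (V i) (V j)\<bar>) / (real n)\<^sup>2"
    by (intro divide_right_mono sum_mono) auto
  also have "\<dots> \<le> (\<Sum>i=1..n. 2 * (\<Sum>r<n. b r)) / (real n)\<^sup>2"
    by (intro divide_right_mono sum_mono row) auto
  also have "\<dots> = 2 * ((\<Sum>r<n. b r) / real n)"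
    using n by (simp add: power2_eq_square field_simps)
  finally show ?thesis .
qed

text \<open>
  Chebyshev's inequality reduces the claim to the variance of the sample mean, which is at most
  twice the Cesaro mean of the null sequence \<open>b\<close>.
\<close>

lemma (in prob_space) weak_law_decaying_covariance:
  fixes V :: "nat \<Rightarrow> 'a \<Rightarrow> real"
  assumes meas: "\<And>i. V i \<in> borel_measurable M"
    and bounded: "\<And>i \<omega>. \<omega> \<in> space M \<Longrightarrow> \<bar>V i \<omega>\<bar> \<le> B"
    and mean: "\<And>i. expectation (V i) = \<mu>"
    and cov: "\<And>i j. 1 \<le> i \<Longrightarrow> i \<le> j \<Longrightarrow> \<bar>Cov M (V i) (V j)\<bar> \<le> b (j - i)"
    and b: "b \<longlonglongrightarrow> 0"
    and e: "e > 0"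
  shows "(\<lambda>n. prob {\<omega> \<in> space M. \<bar>(\<Sum>i=1..n. V i \<omega>) / real n - \<mu>\<bar> \<ge> e}) \<longlonglongrightarrow> 0"
proof (rule tendsto_sandwich[OF _ _ tendsto_const])
  note meas[measurable]
  have int: "integrable M (V i)" for i
    using bounded by (intro integrable_const_bound[where B=B]) auto
  have chebyshev: "prob {\<omega> \<in> space M. \<bar>(\<Sum>i=1..n. V i \<omega>) / real n - \<mu>\<bar> \<ge> e}
      \<le> 2 * ((\<Sum>r<n. b r) / real n) / e\<^sup>2" if n: "n \<ge> 1" for n
  proof -
    let ?S = "\<lambda>\<omega>. (\<Sum>i=1..n. V i \<omega>) / real n"
    have ES: "expectation ?S = \<mu>" using n int mean by simp
    have S_le: "\<bar>?S \<omega>\<bar> \<le> B" if "\<omega> \<in> space M" for \<omega>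
      using bounded[OF that] by (rule abs_mean_le)
    have "integrable M (\<lambda>\<omega>. (?S \<omega>)\<^sup>2)"
    proof (intro integrable_const_bound[where B="B\<^sup>2"] AE_I2)
      show "norm ((?S \<omega>)\<^sup>2) \<le> B\<^sup>2" if "\<omega> \<in> space M" for \<omega>
        using power_mono[OF S_le[OF that], of 2] by (simp only: power2_abs abs_ge_zero real_norm_def abs_power2)
    qed simp
    from Chebyshev_inequality[OF _ this e] ES
    have "prob {\<omega> \<in> space M. \<bar>?S \<omega> - \<mu>\<bar> \<ge> e} \<le> variance ?S / e\<^sup>2" by simp
    also have "\<dots> \<le> 2 * ((\<Sum>r<n. b r) / real n) / e\<^sup>2"
      by (intro divide_right_mono variance_mean_le[where B=B] meas bounded cov n) auto
    finally show ?thesis .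
  qed
  show "\<forall>\<^sub>F n in sequentially. prob {\<omega> \<in> space M. \<bar>(\<Sum>i=1..n. V i \<omega>) / real n - \<mu>\<bar> \<ge> e}
      \<le> 2 * ((\<Sum>r<n. b r) / real n) / e\<^sup>2"
    using eventually_ge_at_top[of 1] by eventually_elim (rule chebyshev)
  show "(\<lambda>n. 2 * ((\<Sum>r<n. b r) / real n) / e\<^sup>2) \<longlonglongrightarrow> 0"
    using tendsto_mult[OF tendsto_const[of "2 / e\<^sup>2"] cesaro_mean_tendsto_zero[OF b]]
    by (simp add: mult.commute)
qed auto


section \<open>Covariances of Lipschitz functions of a weakly dependent process\<close>

lemma lip_const_leD:
  assumes "lip_const d S f \<le> ennreal L" "L \<ge> 0" "x \<in> S" "y \<in> S" "d x y > 0"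
  shows "\<bar>f x - f y\<bar> \<le> L * d x y"
proof (cases "x = y")
  case False
  have "ennreal (\<bar>f x - f y\<bar> / d x y) \<le> lip_const d S f"
    unfolding lip_const_def using False assms(3,4)
    by (intro SUP_upper2[where i="(x, y)"]) auto
  also note assms(1)
  finally show ?thesis using assms(2,5) by (simp add: ennreal_le_iff field_simps)
qed (use assms in simp)

text \<open>
  All four choices of \<open>\<psi>\<close> are at most \<open>3\<close> on one-point functions with Lipschitz constant at most
  \<open>1\<close>, so that \<open>\<theta>\<close>-, \<open>\<eta>\<close>-, \<open>\<kappa>\<close>- and \<open>\<lambda>\<close>-dependence need not be distinguished. Dividing \<open>f\<close> by
  its Lipschitz constant puts it into this class and costs a factor \<open>L\<^sup>2\<close> in the covariance.
\<close>

lemma weakly_dependent_cov_le: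
  assumes wdep: "weakly_dependent M d S Z \<psi> \<epsilon>"
    and psi: "\<psi> \<in> {psi_theta, psi_eta, psi_kappa, psi_lambda}"
    and d: "\<And>x y. d x y \<ge> 0"
    and L: "L > 0"
    and lip: "\<And>x y. x \<in> S \<Longrightarrow> y \<in> S \<Longrightarrow> \<bar>f x - f y\<bar> \<le> L * d x y"
    and bounded: "\<And>x. x \<in> S \<Longrightarrow> \<bar>f x\<bar> \<le> B"
    and r: "r \<ge> 1" "s + int r \<le> t"
  shows "\<bar>Cov M (\<lambda>\<omega>. f (Z s \<omega>)) (\<lambda>\<omega>. f (Z t \<omega>))\<bar> \<le> 3 * L\<^sup>2 * \<bar>\<epsilon> r\<bar>"
proof -
  define g :: "(nat \<Rightarrow> 'b) \<Rightarrow> real" where "g = (\<lambda>x. f (x 1) / L)"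
  define A where "A = lip_const (tuple_dist d 1) (tuples S 1) g"
  have tuple: "x 1 \<in> S" if "x \<in> tuples S 1" for x
    using that unfolding tuples_def by (auto simp: PiE_iff)
  have A: "A \<le> 1" unfolding A_def lip_const_def
  proof (safe intro!: SUP_least)
    fix x y assume xy: "x \<in> tuples S 1" "y \<in> tuples S 1"
    have "\<bar>g x - g y\<bar> = \<bar>f (x 1) - f (y 1)\<bar> / L"
      unfolding g_def using L by (simp flip: diff_divide_distrib)
    also have "\<dots> \<le> d (x 1) (y 1)"
      using lip[OF tuple[OF xy(1)] tuple[OF xy(2)]] L by (simp add: field_simps)
    finally have "\<bar>g x - g y\<bar> / tuple_dist d 1 x y \<le> 1"
      using d[of "x 1" "y 1"] unfolding tuple_dist_def by (simp add: divide_le_eq)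
    then show "ennreal (\<bar>g x - g y\<bar> / tuple_dist d 1 x y) \<le> 1"
      using ennreal_leI by fastforce
  qed
  have "sup_norm_on (tuples S 1) g \<le> ennreal (B / L)" unfolding sup_norm_on_def
  proof (intro SUP_least ennreal_leI)
    fix x assume "x \<in> tuples S 1"
    from bounded[OF tuple[OF this]] show "norm (g x) \<le> B / L"
      unfolding g_def using L by (simp add: field_simps)
  qed
  then have "sup_norm_on (tuples S 1) g < \<infinity>"
    using ennreal_less_top order.strict_trans1 infinity_ennreal_def by metis
  with A have g: "g \<in> Lambda1 d S 1" unfolding Lambda1_def A_def by simp
  define a where "a = enn2real A"
  have a: "0 \<le> a" "a \<le> 1" unfolding a_def using A enn2real_mono[OF A] by auto
  have "mono_on {1..1::nat} (\<lambda>_. s)" "mono_on {1..1::nat} (\<lambda>_. t)" by (auto intro: mono_onI)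
  then have "\<bar>Cov M (\<lambda>\<omega>. g (\<lambda>i\<in>{1..1}. Z s \<omega>)) (\<lambda>\<omega>. g (\<lambda>i\<in>{1..1}. Z t \<omega>))\<bar> \<le> \<psi> a a 1 1 * \<epsilon> r"
    using wdep[unfolded weakly_dependent_def, THEN conjunct2, THEN conjunct2, THEN conjunct2,
        rule_format, of 1 1 r g g "\<lambda>_. s" "\<lambda>_. t"] g r
    unfolding a_def A_def by simp
  also have "\<dots> \<le> 3 * \<bar>\<epsilon> r\<bar>"
  proof -
    have "0 \<le> a * a" "a * a \<le> 1" using a by (auto intro: mult_le_one)
    with psi a have "0 \<le> \<psi> a a 1 1" "\<psi> a a 1 1 \<le> 3"
      by (auto simp: psi_theta_def psi_eta_def psi_kappa_def psi_lambda_def)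
    then show ?thesis
      by (intro order_trans[OF mult_left_mono[of "\<epsilon> r" "\<bar>\<epsilon> r\<bar>"]] mult_right_mono) auto
  qed
  also have "Cov M (\<lambda>\<omega>. g (\<lambda>i\<in>{1..1}. Z s \<omega>)) (\<lambda>\<omega>. g (\<lambda>i\<in>{1..1}. Z t \<omega>))
      = Cov M (\<lambda>\<omega>. f (Z s \<omega>)) (\<lambda>\<omega>. f (Z t \<omega>)) / L\<^sup>2"
  proof -
    have "(x / L - p / L) * (y / L - q / L) = (x - p) * (y - q) / L\<^sup>2" for x y p q :: real
      by (simp add: power2_eq_square flip: diff_divide_distrib)
    then show ?thesis unfolding Cov_def g_def by simp
  qed
  finally show ?thesis using L by (simp add: abs_divide field_simps)
qed


section \<open>Uniform convergence over a totally bounded class\<close>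

lemma tendsto_in_prob_mono:
  assumes W: "tendsto_in_prob M W (\<lambda>_. 0)"
    and c: "c > 0"
    and le: "\<And>n \<omega>. n \<ge> 1 \<Longrightarrow> \<omega> \<in> space M \<Longrightarrow> \<bar>V n \<omega>\<bar> \<le> c * \<bar>W n \<omega>\<bar>"
  shows "tendsto_in_prob M V (\<lambda>_. 0)"
  unfolding tendsto_in_prob_def
proof (intro allI impI)
  fix e :: real assume e: "e > 0"
  have sub: "{\<omega> \<in> space M. \<bar>V n \<omega> - 0\<bar> > e} \<subseteq> {\<omega> \<in> space M. \<bar>W n \<omega> - 0\<bar> > e / c}" if "n \<ge> 1" for n
    using le[OF that] c by (force simp: field_simps)
  show "(\<lambda>n. outer_measure_of M {\<omega> \<in> space M. \<bar>V n \<omega> - 0\<bar> > e}) \<longlonglongrightarrow> 0"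
  proof (rule tendsto_sandwich[OF _ _ tendsto_const])
    show "(\<lambda>n. outer_measure_of M {\<omega> \<in> space M. \<bar>W n \<omega> - 0\<bar> > e / c}) \<longlonglongrightarrow> 0"
      using W e c unfolding tendsto_in_prob_def by simp
    show "\<forall>\<^sub>F n in sequentially. outer_measure_of M {\<omega> \<in> space M. \<bar>V n \<omega> - 0\<bar> > e}
        \<le> outer_measure_of M {\<omega> \<in> space M. \<bar>W n \<omega> - 0\<bar> > e / c}"
      using eventually_ge_at_top[of 1] by eventually_elim (intro outer_measure_of_mono sub)
  qed simp
qed

text \<open>
  The centres of the cover serve all \<open>\<omega>\<close> at the same time, so the event of a large supremum lies in
  the union of finitely many events, one for each centre. A tolerance of \<open>e/4\<close> for each of the
  three errors leaves the supremum strictly below \<open>e\<close> outside this union.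
\<close>

lemma (in prob_space) uniform_law_finite_cover:
  fixes R :: "'h \<Rightarrow> real"
  assumes ne: "H \<noteq> {}"
    and meas: "\<And>n h. h \<in> H \<Longrightarrow> (\<lambda>\<omega>. Rn n \<omega> h) \<in> borel_measurable M"
    and pointwise: "\<And>h e. h \<in> H \<Longrightarrow> e > 0 \<Longrightarrow>
        (\<lambda>n. prob {\<omega> \<in> space M. \<bar>Rn n \<omega> h - R h\<bar> \<ge> e}) \<longlonglongrightarrow> 0"
    and cover: "\<And>r. r > 0 \<Longrightarrow> \<exists>C. finite C \<and> C \<subseteq> H \<and> (\<forall>h\<in>H. \<exists>c\<in>C. \<bar>R h - R c\<bar> \<le> r \<and>
        (\<forall>n. \<forall>\<omega>\<in>space M. \<bar>Rn n \<omega> h - Rn n \<omega> c\<bar> \<le> r))"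
  shows "tendsto_in_prob M (\<lambda>n \<omega>. SUP h\<in>H. \<bar>R h - Rn n \<omega> h\<bar>) (\<lambda>_. 0)"
  unfolding tendsto_in_prob_def
proof (intro allI impI)
  fix e :: real assume e: "e > 0"
  from cover[of "e/4"] e obtain C where C: "finite C" "C \<subseteq> H"
    and near: "\<And>h. h \<in> H \<Longrightarrow> \<exists>c\<in>C. \<bar>R h - R c\<bar> \<le> e/4 \<and>
      (\<forall>n. \<forall>\<omega>\<in>space M. \<bar>Rn n \<omega> h - Rn n \<omega> c\<bar> \<le> e/4)"
    by auto
  define D where "D n c = {\<omega> \<in> space M. \<bar>Rn n \<omega> c - R c\<bar> \<ge> e/4}" for n c
  have D: "D n c \<in> events" if "c \<in> C" for n c
  proof -
    have [measurable]: "(\<lambda>\<omega>. Rn n \<omega> c) \<in> borel_measurable M" using that C meas by blast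
    show ?thesis unfolding D_def by measurable
  qed
  have sub: "{\<omega> \<in> space M. \<bar>(SUP h\<in>H. \<bar>R h - Rn n \<omega> h\<bar>) - 0\<bar> > e} \<subseteq> (\<Union>c\<in>C. D n c)" for n
  proof (rule subsetI, rule ccontr)
    fix \<omega> assume *: "\<omega> \<in> {\<omega> \<in> space M. \<bar>(SUP h\<in>H. \<bar>R h - Rn n \<omega> h\<bar>) - 0\<bar> > e}"
      "\<omega> \<notin> (\<Union>c\<in>C. D n c)"
    then have w: "\<omega> \<in> space M" by simp
    have le: "\<bar>R h - Rn n \<omega> h\<bar> \<le> 3 * (e/4)" if "h \<in> H" for h
    proof -
      from near[OF that] w obtain c where "c \<in> C" "\<bar>R h - R c\<bar> \<le> e/4" "\<bar>Rn n \<omega> h - Rn n \<omega> c\<bar> \<le> e/4"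
        by blast
      moreover have "\<bar>Rn n \<omega> c - R c\<bar> < e/4" using * w \<open>c \<in> C\<close> unfolding D_def by auto
      ultimately show ?thesis by linarith
    qed
    have "(SUP h\<in>H. \<bar>R h - Rn n \<omega> h\<bar>) \<le> 3 * (e/4)"
      using ne le by (intro cSUP_least)
    moreover have "(SUP h\<in>H. \<bar>R h - Rn n \<omega> h\<bar>) \<ge> 0"
    proof -
      from ne obtain h where h: "h \<in> H" by auto
      have "0 \<le> \<bar>R h - Rn n \<omega> h\<bar>" by simp
      also have "\<dots> \<le> (SUP h\<in>H. \<bar>R h - Rn n \<omega> h\<bar>)"
        using h le by (intro cSUP_upper bdd_aboveI2)
      finally show ?thesis .
    qed
    ultimately show False using * e by simp
  qed
  show "(\<lambda>n. outer_measure_of M {\<omega> \<in> space M. \<bar>(SUP h\<in>H. \<bar>R h - Rn n \<omega> h\<bar>) - 0\<bar> > e}) \<longlonglongrightarrow> 0"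
  proof (rule tendsto_sandwich[OF _ _ tendsto_const])
    have "(\<lambda>n. \<Sum>c\<in>C. prob (D n c)) \<longlonglongrightarrow> (\<Sum>c\<in>C. 0)"
      unfolding D_def using C e by (intro tendsto_sum pointwise) auto
    then show "(\<lambda>n. ennreal (\<Sum>c\<in>C. prob (D n c))) \<longlonglongrightarrow> 0"
      using tendsto_ennrealI by fastforce
    have "outer_measure_of M {\<omega> \<in> space M. \<bar>(SUP h\<in>H. \<bar>R h - Rn n \<omega> h\<bar>) - 0\<bar> > e}
        \<le> ennreal (\<Sum>c\<in>C. prob (D n c))" for n
    proof -
      have U: "(\<Union>c\<in>C. D n c) \<in> events" using C D by auto
      have "outer_measure_of M {\<omega> \<in> space M. \<bar>(SUP h\<in>H. \<bar>R h - Rn n \<omega> h\<bar>) - 0\<bar> > e}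
          \<le> emeasure M (\<Union>c\<in>C. D n c)"
        using outer_measure_of_mono[OF sub, of M n] unfolding outer_measure_of_eq[OF U] .
      also have "\<dots> = ennreal (prob (\<Union>c\<in>C. D n c))" by (rule emeasure_eq_measure)
      also have "\<dots> \<le> ennreal (\<Sum>c\<in>C. prob (D n c))"
        using C D by (intro ennreal_leI finite_measure_subadditive_finite) auto
      finally show ?thesis .
    qed
    then show "\<forall>\<^sub>F n in sequentially.
        outer_measure_of M {\<omega> \<in> space M. \<bar>(SUP h\<in>H. \<bar>R h - Rn n \<omega> h\<bar>) - 0\<bar> > e}
        \<le> ennreal (\<Sum>c\<in>C. prob (D n c))"
      by simp
  qed simp
qed

text \<open>
  The usual splitting
  \<open>R h' - R h = (R h' - r h') + (r h' - r h) + (r h - R h)\<close>, whose middle term is at most zero.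
\<close>

lemma excess_risk_le:
  fixes R r :: "'h \<Rightarrow> real"
  assumes "is_arg_min R (\<lambda>h. h \<in> H) h" "is_arg_min r (\<lambda>h. h \<in> H) h'"
    and bdd: "bdd_above ((\<lambda>h. \<bar>R h - r h\<bar>) ` H)"
  shows "\<bar>R h' - R h\<bar> \<le> 2 * \<bar>SUP h\<in>H. \<bar>R h - r h\<bar>\<bar>"
proof -
  have h: "h \<in> H" "h' \<in> H" and le: "R h \<le> R h'" "r h' \<le> r h"
    using assms(1,2) by (auto simp: is_arg_min_linorder)
  have "\<bar>R h - r h\<bar> \<le> (SUP h\<in>H. \<bar>R h - r h\<bar>)" "\<bar>R h' - r h'\<bar> \<le> (SUP h\<in>H. \<bar>R h - r h\<bar>)"
    using h bdd by (auto intro: cSUP_upper)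
  with le show ?thesis by linarith
qed

lemma finite_cover_of_covering_number:
  assumes "covering_number S H r < \<infinity>" "r \<ge> 0"
  shows "\<exists>C. finite C \<and> C \<subseteq> H \<and> (\<forall>h\<in>H. \<exists>c\<in>C. \<forall>x\<in>S. norm (h x - c x) \<le> r)"
proof -
  define P where "P m \<longleftrightarrow> (\<exists>c. (\<forall>i\<in>{1..m}. c i \<in> H) \<and>
      (\<forall>h\<in>H. \<exists>i\<in>{1..m}. sup_norm_on S (\<lambda>x. h x - c i x) \<le> ennreal r))" for m :: nat
  have "covering_number S H r = Inf {enat m | m. 1 \<le> m \<and> P m}"
    unfolding covering_number_def P_def ..
  with assms(1) have "{enat m | m. 1 \<le> m \<and> P m} \<noteq> {}"
    by (metis Inf_enat_def infinity_ne_i0 less_irrefl)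
  then obtain m where "P m" by blast
  then obtain c where c: "\<forall>i\<in>{1..m}. c i \<in> H"
    "\<forall>h\<in>H. \<exists>i\<in>{1..m}. sup_norm_on S (\<lambda>x. h x - c i x) \<le> ennreal r"
    unfolding P_def by blast
  have "\<exists>k\<in>c ` {1..m}. \<forall>x\<in>S. norm (h x - k x) \<le> r" if "h \<in> H" for h
  proof -
    from c(2) that obtain i where i: "i \<in> {1..m}" "sup_norm_on S (\<lambda>x. h x - c i x) \<le> ennreal r"
      by blast
    then show ?thesis using assms(2) by (auto simp: sup_norm_on_def SUP_le_iff ennreal_le_iff)
  qed
  with c(1) show ?thesis by (intro exI[of _ "c ` {1..m}"]) auto
qed


section \<open>Consistency of empirical risk minimization\<close>

lemma stationary_expectation_eq:
  fixes f :: "'e \<Rightarrow> real"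
  assumes stat: "stationary M S Z" and rv: "\<And>t. Z t \<in> measurable M S" and f: "f \<in> borel_measurable S"
  shows "(\<integral>\<omega>. f (Z t \<omega>) \<partial>M) = (\<integral>\<omega>. f (Z 0 \<omega>) \<partial>M)"
proof -
  note rv[measurable] f[measurable]
  have "(\<integral>\<omega>. f (Z (0 + k) \<omega>) \<partial>M) = (\<integral>x. f (x 0) \<partial>path_law M S (\<lambda>t. Z (t + k)))" for k
    unfolding path_law_def by (subst integral_distr) (auto intro!: measurable_PiM_single' simp: measurable_space[OF rv])
  from this[of t] this[of 0] show ?thesis using stat unfolding stationary_def by simp
qed

theorem mainTheorem5:
  fixes M :: "'w measure"
    and \<X> :: "'a::{banach, second_countable_topology} set"
    and \<Y> :: "'b::{banach, second_countable_topology} set"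
    and X :: "int \<Rightarrow> 'w \<Rightarrow> 'a"
    and Y :: "int \<Rightarrow> 'w \<Rightarrow> 'b"
    and \<H> :: "('a \<Rightarrow> 'b) set"
    and l :: "'b \<times> 'b \<Rightarrow> real"
    and \<psi> :: "real \<Rightarrow> real \<Rightarrow> nat \<Rightarrow> nat \<Rightarrow> real"
    and \<epsilon> :: "nat \<Rightarrow> real"
    and \<gamma> :: real
    and h_target :: "'a \<Rightarrow> 'b"
    and h_hat :: "nat \<Rightarrow> 'w \<Rightarrow> 'a \<Rightarrow> 'b"
  defines "Z \<equiv> \<lambda>t \<omega>. (X t \<omega>, Y t \<omega>)"
    and "R \<equiv> risk M l X Y"
    and "R_emp \<equiv> emp_risk l X Y"
  assumes prob: "prob_space M"
    and rv: "\<And>t. Z t \<in> measurable M (restrict_space borel (\<X> \<times> \<Y>))"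
    and predictors: "\<H> \<subseteq> \<X> \<rightarrow> \<Y>"
    and loss: "l \<in> \<Y> \<times> \<Y> \<rightarrow> {0..}"
    and target: "is_arg_min R (\<lambda>h. h \<in> \<H>) h_target"
    and emp_target: "\<And>n \<omega>. n \<ge> 1 \<Longrightarrow> \<omega> \<in> space M \<Longrightarrow>
          is_arg_min (R_emp n \<omega>) (\<lambda>h. h \<in> \<H>) (h_hat n \<omega>)"
    and A1_lip: "\<exists>K>0. \<forall>h\<in>\<H>. sup_norm_on \<X> h < \<infinity> \<and> K-lipschitz_on \<X> h"
    and A1_sup: "(SUP h\<in>\<H>. sup_norm_on \<X> h) < \<infinity>"
    and A2_lip: "\<exists>K>0. sup_norm_on (\<Y> \<times> \<Y>) l < \<infinity> \<and> lip_const sum_dist (\<Y> \<times> \<Y>) l \<le> ennreal K"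
    and A2_sup: "(SUP h\<in>\<H>. SUP (x, y)\<in>\<X> \<times> \<Y>. ennreal \<bar>l (h x, y)\<bar>) < \<infinity>"
    and stat: "stationary M (restrict_space borel (\<X> \<times> \<Y>)) Z"
    and erg: "ergodic M (restrict_space borel (\<X> \<times> \<Y>)) Z"
    and psi: "\<psi> \<in> {psi_theta, psi_eta, psi_kappa, psi_lambda}"
    and wdep: "weakly_dependent M sum_dist (\<X> \<times> \<Y>) Z \<psi> \<epsilon>"
    and gamma: "\<gamma> > 3"
    and rate: "\<epsilon> \<in> O(\<lambda>j. real j powr (- \<gamma>))"
    and covering: "\<And>r. r > 0 \<Longrightarrow> covering_number \<X> \<H> r < \<infinity>"
  shows "tendsto_in_prob M (\<lambda>n \<omega>. SUP h\<in>\<H>. \<bar>R h - R_emp n \<omega> h\<bar>) (\<lambda>_. 0) \<and>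
         tendsto_in_prob M (\<lambda>n \<omega>. R (h_hat n \<omega>) - R h_target) (\<lambda>_. 0)"
proof -
  interpret prob_space M by (rule prob)
  let ?S = "\<X> \<times> \<Y>"
  have inS: "Z t \<omega> \<in> ?S" if "\<omega> \<in> space M" for t \<omega>
    using measurable_space[OF rv that, of t] by (simp add: space_restrict_space)
  have HY: "h x \<in> \<Y>" if "h \<in> \<H>" "x \<in> \<X>" for h x using predictors that by blast
  have ne: "\<H> \<noteq> {}" using target by (auto simp: is_arg_min_def)

  obtain K where K: "K > 0" and lipH: "\<And>h. h \<in> \<H> \<Longrightarrow> K-lipschitz_on \<X> h"
    using A1_lip by auto
  obtain L where L: "L > 0" and l_sup: "sup_norm_on (\<Y> \<times> \<Y>) l < \<infinity>"
    and l_lip: "lip_const sum_dist (\<Y> \<times> \<Y>) l \<le> ennreal L"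
    using A2_lip by auto
  define B where "B = enn2real (sup_norm_on (\<Y> \<times> \<Y>) l)"
  have l_le: "\<bar>l p\<bar> \<le> B" if "p \<in> \<Y> \<times> \<Y>" for p
  proof -
    have "ennreal \<bar>l p\<bar> \<le> sup_norm_on (\<Y> \<times> \<Y>) l"
      unfolding sup_norm_on_def using that by (intro SUP_upper2[of p]) auto
    also have "\<dots> = ennreal B" unfolding B_def using l_sup by simp
    finally show ?thesis by (simp add: B_def ennreal_le_iff)
  qed
  have l_diff: "\<bar>l p - l q\<bar> \<le> L * sum_dist p q" if "p \<in> \<Y> \<times> \<Y>" "q \<in> \<Y> \<times> \<Y>" for p q
  proof (cases "p = q")
    case False
    then have "sum_dist p q > 0"
      by (cases p; cases q) (auto simp: sum_dist_def intro: add_pos_nonneg add_nonneg_pos)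
    with lip_const_leD[OF l_lip _ that] L show ?thesis by simp
  qed (simp add: sum_dist_def)

  define f :: "('a \<Rightarrow> 'b) \<Rightarrow> 'a \<times> 'b \<Rightarrow> real" where "f h z = l (h (fst z), snd z)" for h z
  have f_le: "\<bar>f h z\<bar> \<le> B" if "h \<in> \<H>" "z \<in> ?S" for h z
    unfolding f_def using that HY by (intro l_le) auto
  have f_near: "\<bar>f h z - f c z\<bar> \<le> L * norm (h (fst z) - c (fst z))"
    if "h \<in> \<H>" "c \<in> \<H>" "z \<in> ?S" for h c z
    using l_diff[of "(h (fst z), snd z)" "(c (fst z), snd z)"] that HY
    unfolding f_def sum_dist_def by auto
  define L' where "L' = L * (K + 1)"
  have L': "L' > 0" unfolding L'_def using L K by simp
  have f_lip: "\<bar>f h z - f h w\<bar> \<le> L' * sum_dist z w" if h: "h \<in> \<H>" and zw: "z \<in> ?S" "w \<in> ?S" for h z w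
  proof -
    have "norm (h (fst z) - h (fst w)) \<le> K * norm (fst z - fst w)"
      using lipschitz_onD[OF lipH[OF h], of "fst z" "fst w"] zw by (auto simp: dist_norm)
    moreover have "0 \<le> K * norm (snd z - snd w)" using K by simp
    ultimately have "norm (h (fst z) - h (fst w)) + norm (snd z - snd w) \<le> (K + 1) * sum_dist z w"
      unfolding sum_dist_def distrib_left distrib_right mult_1
      using norm_ge_zero[of "fst z - fst w"] by linarith
    moreover have "\<bar>f h z - f h w\<bar> \<le> L * (norm (h (fst z) - h (fst w)) + norm (snd z - snd w))"
      using l_diff[of "(h (fst z), snd z)" "(h (fst w), snd w)"] h zw HY
      unfolding f_def sum_dist_def by auto
    ultimately show ?thesis
      unfolding L'_def using L by (smt (verit) mult.assoc mult_left_mono)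
  qed
  have f_meas: "f h \<in> borel_measurable (restrict_space borel ?S)" if h: "h \<in> \<H>" for h
  proof (intro borel_measurable_continuous_on_restrict lipschitz_on_continuous_on lipschitz_onI)
    fix z w assume zw: "z \<in> ?S" "w \<in> ?S"
    \<comment> \<open>\<open>dist\<close> is the Euclidean distance of the product, which dominates both components.\<close>
    have "sum_dist z w \<le> 2 * dist z w"
      unfolding sum_dist_def
      using dist_fst_le[of z w] dist_snd_le[of z w] by (simp add: dist_norm)
    then have "L' * sum_dist z w \<le> L' * (2 * dist z w)" using L' by (intro mult_left_mono) auto
    with f_lip[OF h zw] show "dist (f h z) (f h w) \<le> (2 * L') * dist z w"
      by (simp add: dist_real_def)
  qed (use L' in simp)

  have R_eq: "R h = expectation (\<lambda>\<omega>. f h (Z 0 \<omega>))" for h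
    by (simp add: R_def risk_def f_def Z_def)
  have R_emp_eq: "R_emp n \<omega> h = (\<Sum>i=1..n. f h (Z (int i) \<omega>)) / real n" for n \<omega> h
    by (simp add: R_emp_def emp_risk_def f_def Z_def)
  have fZ_meas[measurable]: "(\<lambda>\<omega>. f h (Z t \<omega>)) \<in> borel_measurable M" if "h \<in> \<H>" for h t
    using measurable_compose[OF rv f_meas[OF that]] .
  have fZ_int: "integrable M (\<lambda>\<omega>. f h (Z t \<omega>))" if "h \<in> \<H>" for h t
    using that f_le inS by (intro integrable_const_bound[where B=B]) auto
  have eps: "\<epsilon> \<longlonglongrightarrow> 0" using wdep unfolding weakly_dependent_def by blast
  have pointwise: "(\<lambda>n. prob {\<omega> \<in> space M. \<bar>R_emp n \<omega> h - R h\<bar> \<ge> e}) \<longlonglongrightarrow> 0"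
    if h: "h \<in> \<H>" and e: "e > 0" for h e
  proof -
    let ?V = "\<lambda>i \<omega>. f h (Z (int i) \<omega>)"
    \<comment> \<open>Weak dependence says nothing about the gap \<open>0\<close>, so the variances get a constant bound.\<close>
    define b where "b r = (if r = 0 then (2 * B)\<^sup>2 else 3 * L'\<^sup>2 * \<bar>\<epsilon> r\<bar>)" for r
    have "(\<lambda>r. 3 * L'\<^sup>2 * \<bar>\<epsilon> r\<bar>) \<longlonglongrightarrow> 3 * L'\<^sup>2 * \<bar>0\<bar>"
      by (intro tendsto_intros eps)
    then have "(\<lambda>r. 3 * L'\<^sup>2 * \<bar>\<epsilon> r\<bar>) \<longlonglongrightarrow> 0" by simp
    then have b: "b \<longlonglongrightarrow> 0"
      by (rule Lim_transform_eventually)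
        (use eventually_gt_at_top[of 0] in \<open>eventually_elim, simp add: b_def\<close>)
    have cov: "\<bar>Cov M (?V i) (?V j)\<bar> \<le> b (j - i)" if ij: "1 \<le> i" "i \<le> j" for i j
    proof (cases "i = j")
      case False
      then have "\<bar>Cov M (?V i) (?V j)\<bar> \<le> 3 * L'\<^sup>2 * \<bar>\<epsilon> (j - i)\<bar>"
        using ij h f_lip f_le
        by (intro weakly_dependent_cov_le[OF wdep psi _ L', where B=B]) (auto simp: sum_dist_def)
      then show ?thesis using False ij by (simp add: b_def)
    next
      case True
      define m where "m = expectation (?V i)"
      have m: "\<bar>m\<bar> \<le> B" unfolding m_def by (rule abs_expectation_le) (use h fZ_int f_le inS in auto)
      have d: "\<bar>?V i \<omega> - m\<bar> \<le> 2 * B" if "\<omega> \<in> space M" for \<omega>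
        using m f_le[OF h inS[OF that], of "int i"] by linarith
      have sq: "\<bar>(?V i \<omega> - m) * (?V i \<omega> - m)\<bar> \<le> (2 * B)\<^sup>2" if "\<omega> \<in> space M" for \<omega>
        using power_mono[OF d[OF that], of 2] by (simp add: power2_eq_square abs_mult)
      have "integrable M (\<lambda>\<omega>. (?V i \<omega> - m) * (?V i \<omega> - m))"
        using sq h by (intro integrable_const_bound[where B="(2*B)\<^sup>2"]) auto
      from abs_expectation_le[OF this sq] True show ?thesis by (simp add: Cov_def m_def b_def)
    qed
    have "expectation (?V i) = R h" for i
      unfolding R_eq using stationary_expectation_eq[OF stat rv f_meas[OF h]] .
    then show ?thesis
      unfolding R_emp_eq using h f_le inS
      by (intro weak_law_decaying_covariance[where B=B and b=b] cov b e) auto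
  qed

  have cover: "\<exists>C. finite C \<and> C \<subseteq> \<H> \<and> (\<forall>h\<in>\<H>. \<exists>c\<in>C. \<bar>R h - R c\<bar> \<le> r \<and>
      (\<forall>n. \<forall>\<omega>\<in>space M. \<bar>R_emp n \<omega> h - R_emp n \<omega> c\<bar> \<le> r))" if r: "r > 0" for r
  proof -
    have "r / L > 0" using r L by simp
    from finite_cover_of_covering_number[OF covering[OF this]] this
    obtain C where C: "finite C" "C \<subseteq> \<H>"
      and near: "\<And>h. h \<in> \<H> \<Longrightarrow> \<exists>c\<in>C. \<forall>x\<in>\<X>. norm (h x - c x) \<le> r / L"
      by auto
    have "\<exists>c\<in>C. \<bar>R h - R c\<bar> \<le> r \<and> (\<forall>n. \<forall>\<omega>\<in>space M. \<bar>R_emp n \<omega> h - R_emp n \<omega> c\<bar> \<le> r)"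
      if h: "h \<in> \<H>" for h
    proof -
      from near[OF h] obtain c where c: "c \<in> C" and hc: "\<And>x. x \<in> \<X> \<Longrightarrow> norm (h x - c x) \<le> r / L"
        by blast
      have c': "c \<in> \<H>" using c C by blast
      have close: "\<bar>f h (Z t \<omega>) - f c (Z t \<omega>)\<bar> \<le> r" if w: "\<omega> \<in> space M" for t \<omega>
      proof -
        have "fst (Z t \<omega>) \<in> \<X>" using inS[OF w, of t] by auto
        from hc[OF this] have "L * norm (h (fst (Z t \<omega>)) - c (fst (Z t \<omega>))) \<le> r"
          using L by (simp add: field_simps)
        with f_near[OF h c' inS[OF w]] show ?thesis by (rule order_trans)
      qed
      have "\<bar>R h - R c\<bar> \<le> r"
      proof -
        have "R h - R c = expectation (\<lambda>\<omega>. f h (Z 0 \<omega>) - f c (Z 0 \<omega>))"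
          unfolding R_eq using fZ_int h c' by simp
        also have "\<bar>\<dots>\<bar> \<le> r" by (rule abs_expectation_le) (use fZ_int h c' close in auto)
        finally show ?thesis .
      qed
      moreover have "\<bar>R_emp n \<omega> h - R_emp n \<omega> c\<bar> \<le> r" if "\<omega> \<in> space M" for n \<omega>
        using abs_mean_le[of "\<lambda>i. f h (Z (int i) \<omega>) - f c (Z (int i) \<omega>)" r n] close[OF that]
        by (simp add: R_emp_eq sum_subtractf diff_divide_distrib)
      ultimately show ?thesis using c by blast
    qed
    with C show ?thesis by blast
  qed

  have emp_meas: "(\<lambda>\<omega>. R_emp n \<omega> h) \<in> borel_measurable M" if "h \<in> \<H>" for n h
    unfolding R_emp_eq using that by measurable
  have uniform: "tendsto_in_prob M (\<lambda>n \<omega>. SUP h\<in>\<H>. \<bar>R h - R_emp n \<omega> h\<bar>) (\<lambda>_. 0)"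
    by (rule uniform_law_finite_cover[OF ne emp_meas pointwise cover])
  moreover have "tendsto_in_prob M (\<lambda>n \<omega>. R (h_hat n \<omega>) - R h_target) (\<lambda>_. 0)"
  proof (rule tendsto_in_prob_mono[OF uniform, of 2])
    fix n \<omega> assume n: "n \<ge> (1::nat)" and w: "\<omega> \<in> space M"
    have "\<bar>R h - R_emp n \<omega> h\<bar> \<le> B + B" if h: "h \<in> \<H>" for h
    proof -
      have "\<bar>R h\<bar> \<le> B" unfolding R_eq by (rule abs_expectation_le) (use h fZ_int f_le inS in auto)
      moreover have "\<bar>R_emp n \<omega> h\<bar> \<le> B"
        unfolding R_emp_eq by (rule abs_mean_le) (use h f_le inS w in auto)
      ultimately show ?thesis by linarith
    qed
    then show "\<bar>R (h_hat n \<omega>) - R h_target\<bar> \<le> 2 * \<bar>SUP h\<in>\<H>. \<bar>R h - R_emp n \<omega> h\<bar>\<bar>"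
      by (intro excess_risk_le[OF target emp_target[OF n w]] bdd_aboveI2)
  qed simp
  ultimately show ?thesis ..
qed

end
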